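(* Let $W$ be a non-negative, integer-valued random variable such that $\mathbb{E}W=\lambda>0$ and $W+1\geq_{st}W^\star$, where $W^\star$ has the $W$-size-biased distribution. Let $t>0$. Then $$\mathbb{P}(W\geq\lambda+t)\leq e^t\left(1+\frac{t}{\lambda}\right)^{-(t+\lambda)},$$ and, if $t<\lambda$, $$\mathbb{P}(W\leq\lambda-t)\leq e^{-t}\left(1-\frac{t}{\lambda}\right)^{t-\lambda}.$$
   Context: $W^\star$ has mass function $\mathbb{P}(W^\star=j)=j\,\mathbb{P}(W=j)/\lambda$, $j\in\{0,1,2,\ldots\}$. $\geq_{st}$ denotes the usual stochastic order. *)

theory Defs
  imports "HOL-Probability.Probability"
begin

text \<open>
  The usual stochastic order \<open>X \<ge>\<^sub>s\<^sub>t Y\<close>. It compares only the laws, so the two variables may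
  live on different probability spaces.
\<close>

definition st_ge :: "'a measure \<Rightarrow> ('a \<Rightarrow> real) \<Rightarrow> 'b measure \<Rightarrow> ('b \<Rightarrow> real) \<Rightarrow> bool" where
  "st_ge M X N Y \<longleftrightarrow> (\<forall>x::real. \<P>(\<omega> in M. X \<omega> > x) \<ge> \<P>(\<omega> in N. Y \<omega> > x))"

text \<open>
  \<open>V\<close> (on \<open>N\<close>) has the size-biased distribution of \<open>W\<close> (on \<open>M\<close>). Meaningful when
  \<open>W\<close> is integrable with positive mean; the right-hand sides then sum to 1.
\<close>

definition has_size_biased_dist ::
    "'a measure \<Rightarrow> ('a \<Rightarrow> nat) \<Rightarrow> 'b measure \<Rightarrow> ('b \<Rightarrow> nat) \<Rightarrow> bool" where
  "has_size_biased_dist M W N V \<longleftrightarrow>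
     (\<forall>j::nat. \<P>(\<omega> in N. V \<omega> = j) =
        real j * \<P>(\<omega> in M. W \<omega> = j) / (\<integral>\<omega>. real (W \<omega>) \<partial>M))"

end

theory Submission
  imports Defs
begin

text \<open>
  The tails of the size-biased law are \<open>\<P>(W\<^sup>\<star> > k) = \<E>[W; W > k] / \<lambda>\<close>, so the hypothesis
  on \<open>W\<^sup>\<star>\<close> is the inequality \<open>\<E>[W; W > k] \<le> \<lambda> \<P>(W \<ge> k)\<close>, which concerns \<open>W\<close> alone. Writing a
  bounded increasing \<open>f\<close> as a mixture of indicators of \<open>{k<..}\<close> turns this into
  \<open>\<E>[W f(W - 1)] \<le> \<lambda> \<E> f(W)\<close> (lemma \<open>size_bias_mono\<close>), with the reverse inequality for decreasing
  \<open>f\<close>. With equality for all \<open>f\<close> this would be Stein's characterisation of the Poisson law.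

  Applied to powers \<open>f(w) = s\<^sup>w\<close>, it is a differential inequality for \<open>G(s) = \<E> s\<^sup>W\<close>:
  \<open>G' \<le> \<lambda> G\<close> for \<open>s \<ge> 1\<close> and \<open>G' \<ge> \<lambda> G\<close> for \<open>s \<le> 1\<close>. Since \<open>G(1) = 1\<close>, on both sides of \<open>1\<close> the
  function \<open>G(s)\<close> is at most \<open>exp (\<lambda> (s - 1))\<close>, the Poisson generating function, and Markov's
  inequality for \<open>s\<^sup>W\<close> with \<open>s = 1 + t/\<lambda>\<close>, respectively \<open>s = 1 - t/\<lambda>\<close>, gives the two bounds.

  Two devices keep this elementary. As \<open>x \<mapsto> x\<^sup>m\<close> is convex, the differential inequality is
  available in difference form and is integrated by iterating over a fine grid (lemma
  \<open>discrete_gronwall\<close>), so \<open>G\<close> is never differentiated. For \<open>s > 1\<close> finiteness of \<open>G(s)\<close> is not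
  known beforehand; there \<open>W\<close> is replaced by \<open>min W n\<close>, which still satisfies
  the upper differential inequality and is equal to \<open>W\<close> below the level \<open>n\<close>.
\<close>

section \<open>Analytic preliminaries\<close>

lemma power_above_tangent:
  fixes r s :: real
  assumes "r > 0" "s > 0"
  shows "s ^ m + real m * s ^ (m - 1) * (r - s) \<le> r ^ m"
proof (cases m)
  case (Suc l)
  have "1 + real m * (r / s - 1) \<le> (1 + (r / s - 1)) ^ m"
    by (rule Bernoulli_inequality) (use assms in auto)
  then have "s ^ m * (1 + real m * (r / s - 1)) \<le> s ^ m * (r / s) ^ m"
    using assms by (intro mult_left_mono) auto
  also have "\<dots> = r ^ m"
    using assms by (simp add: power_divide)
  also have "s ^ m * (1 + real m * (r / s - 1)) = s ^ m + real m * s ^ (m - 1) * (r - s)"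
    using assms Suc by (simp add: field_simps)
  finally show ?thesis .
qed simp

text \<open>
  A form of Gronwall's inequality for \<open>G' \<le> L G\<close>. On the grid of mesh \<open>1/n\<close> the hypothesis iterates
  to \<open>(1 - L/n)\<^sup>n G(1) \<le> G(0)\<close>, and the factor tends to \<open>exp (-L)\<close>. The sign of \<open>L\<close> is arbitrary,
  which allows one to follow the generating function to either side of \<open>1\<close>.
\<close>

lemma discrete_gronwall:
  fixes G :: "real \<Rightarrow> real"
  assumes step: "\<And>u v. 0 \<le> u \<Longrightarrow> u \<le> v \<Longrightarrow> v \<le> 1 \<Longrightarrow> (1 - L * (v - u)) * G v \<le> G u"
  shows "G 1 \<le> exp L * G 0"
proof -
  have grid: "(1 - L / n) ^ k * G (k / n) \<le> G 0" if "n > \<bar>L\<bar>" "k \<le> n" for n k :: nat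
    using \<open>k \<le> n\<close>
  proof (induction k)
    case (Suc k)
    have pos: "real n > 0" "1 - L / n \<ge> 0"
      using that by (auto simp: field_simps)
    have "(1 - L * (Suc k / n - k / n)) * G (Suc k / n) \<le> G (k / n)"
      using Suc.prems pos by (intro step) (auto simp: field_simps)
    moreover have "Suc k / n - k / n = 1 / n"
      using pos by (simp add: field_simps)
    ultimately have "(1 - L / n) * G (Suc k / n) \<le> G (k / n)"
      by simp
    then have "(1 - L / n) ^ k * ((1 - L / n) * G (Suc k / n)) \<le> (1 - L / n) ^ k * G (k / n)"
      using pos by (intro mult_left_mono) auto
    also have "\<dots> \<le> G 0"
      using Suc by simp
    finally show ?case
      by (simp add: mult_ac)
  qed simp
  have "(\<lambda>n. (1 + (- L) / real n) ^ n * G 1) \<longlonglongrightarrow> exp (- L) * G 1"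
    by (intro tendsto_mult tendsto_exp_limit_sequentially tendsto_const)
  moreover have "\<forall>\<^sub>F n in sequentially. (1 + (- L) / real n) ^ n * G 1 \<le> G 0"
    using filterlim_real_sequentially[unfolded filterlim_at_top_dense, rule_format, of "\<bar>L\<bar>"]
  proof eventually_elim
    case (elim n)
    then have "n > 0" by (cases n) auto
    with grid[of n n] elim show ?case by simp
  qed
  ultimately have "exp (- L) * G 1 \<le> G 0"
    by (intro tendsto_upperbound) auto
  then have "exp L * (exp (- L) * G 1) \<le> exp L * G 0"
    by simp
  then show ?thesis
    by (simp add: mult.assoc[symmetric] exp_minus)
qed

text \<open>
  This carries inequalities between tails over to increasing \<open>f\<close>, whose coefficients here are
  non-negative. The truncation keeps the sum finite, so expectations can be taken termwise.
\<close>

lemma truncation_as_indicator_sum: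
  fixes f :: "nat \<Rightarrow> real"
  shows "f (min m n) = f 0 + (\<Sum>k<n. (f (Suc k) - f k) * indicat_real {k<..} m)"
proof -
  have "(\<Sum>k<n. (f (Suc k) - f k) * indicat_real {k<..} m) = (\<Sum>k<min m n. f (Suc k) - f k)"
    by (rule sum.mono_neutral_cong_right) (auto simp: indicator_def)
  then show ?thesis
    by (simp add: sum_lessThan_telescope)
qed

section \<open>From size bias to a generating function bound\<close>

context prob_space
begin

text \<open>
  Summing the point masses \<open>j \<P>(W = j)\<close> over \<open>j \<le> k\<close> gives \<open>\<E>[W; W \<le> k] = \<lambda> \<P>(W\<^sup>\<star> \<le> k)\<close>. Taking
  complements uses that the law of \<open>W\<^sup>\<star>\<close> has total mass \<open>1\<close> and that \<open>W\<close> has mean \<open>\<lambda>\<close>.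
\<close>

lemma size_bias_tail:
  fixes W :: "'a \<Rightarrow> nat" and V :: "'b \<Rightarrow> nat"
  assumes N: "prob_space N"
    and W [measurable]: "W \<in> measurable M (count_space UNIV)"
    and V [measurable]: "V \<in> measurable N (count_space UNIV)"
    and int: "integrable M (\<lambda>\<omega>. real (W \<omega>))"
    and mean: "expectation (\<lambda>\<omega>. real (W \<omega>)) = lam" and "lam > 0"
    and bias: "has_size_biased_dist M W N V"
  shows "expectation (\<lambda>\<omega>. real (W \<omega>) * indicat_real {k<..} (W \<omega>)) = lam * \<P>(\<omega> in N. V \<omega> > k)"
proof -
  interpret N: prob_space N by (rule N)
  have mass: "expectation (\<lambda>\<omega>. real j * indicat_real {j} (W \<omega>)) = lam * \<P>(\<omega> in N. V \<omega> = j)" for j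
  proof -
    have "expectation (\<lambda>\<omega>. indicat_real {j} (W \<omega>)) = expectation (indicat_real {\<omega>\<in>space M. W \<omega> = j})"
      by (rule Bochner_Integration.integral_cong) (auto simp: indicator_def)
    then have "expectation (\<lambda>\<omega>. indicat_real {j} (W \<omega>)) = \<P>(\<omega> in M. W \<omega> = j)"
      by simp
    then show ?thesis
      using bias \<open>lam > 0\<close> by (simp add: has_size_biased_dist_def mean)
  qed
  have split: "real m * indicat_real {k<..} m = real m - (\<Sum>j\<le>k. real j * indicat_real {j} m)" for m
  proof -
    have "(\<Sum>j\<le>k. real j * indicat_real {j} m) = (\<Sum>j\<le>k. if m = j then real j else 0)"
      by (rule sum.cong) (auto simp: indicator_def)
    then show ?thesis
      by (auto simp: indicator_def)
  qed
  have intj: "integrable M (\<lambda>\<omega>. real j * indicat_real {j} (W \<omega>))" for j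
    by (rule integrable_const_bound[of _ "real j"]) (auto simp: indicator_def)
  have "expectation (\<lambda>\<omega>. real (W \<omega>) * indicat_real {k<..} (W \<omega>))
      = lam - (\<Sum>j\<le>k. lam * \<P>(\<omega> in N. V \<omega> = j))"
    unfolding split Bochner_Integration.integral_diff[OF int Bochner_Integration.integrable_sum[OF intj]]
      Bochner_Integration.integral_sum[OF intj] mass mean ..
  also have "(\<Sum>j\<le>k. lam * \<P>(\<omega> in N. V \<omega> = j)) = lam * \<P>(\<omega> in N. V \<omega> \<le> k)"
  proof -
    have "N.prob (\<Union>j\<in>{..k}. {\<omega>\<in>space N. V \<omega> = j}) = (\<Sum>j\<le>k. \<P>(\<omega> in N. V \<omega> = j))"
      by (rule N.finite_measure_finite_Union) (auto simp: disjoint_family_on_def)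
    moreover have "(\<Union>j\<in>{..k}. {\<omega>\<in>space N. V \<omega> = j}) = {\<omega>\<in>space N. V \<omega> \<le> k}"
      by auto
    ultimately show ?thesis
      by (simp add: sum_distrib_left)
  qed
  also have "\<P>(\<omega> in N. V \<omega> \<le> k) = 1 - \<P>(\<omega> in N. V \<omega> > k)"
    using N.prob_neg[of "\<lambda>\<omega>. V \<omega> > k"] by (simp add: not_less)
  finally show ?thesis
    by (simp add: algebra_simps)
qed

text \<open>
  By truncation \<open>f\<close> may be taken to be a finite combination of indicators of \<open>{k<..}\<close> with
  non-negative coefficients, and for a single indicator the claim is the tail hypothesis at \<open>k + 1\<close>,
  because \<open>W - 1 > k\<close> means \<open>W > k + 1\<close>. Dominated convergence removes the truncation.
\<close>

lemma size_bias_mono: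
  fixes W :: "'a \<Rightarrow> nat" and f :: "nat \<Rightarrow> real"
  assumes W [measurable]: "W \<in> measurable M (count_space UNIV)"
    and int: "integrable M (\<lambda>\<omega>. real (W \<omega>))"
    and mean: "expectation (\<lambda>\<omega>. real (W \<omega>)) = lam"
    and tail: "\<And>k. expectation (\<lambda>\<omega>. real (W \<omega>) * indicat_real {k<..} (W \<omega>)) \<le> lam * \<P>(\<omega> in M. W \<omega> \<ge> k)"
    and f: "mono f" "\<And>w. \<bar>f w\<bar> \<le> B"
  shows "expectation (\<lambda>\<omega>. real (W \<omega>) * f (W \<omega> - 1)) \<le> lam * expectation (\<lambda>\<omega>. f (W \<omega>))"
proof (rule LIMSEQ_le)
  have B: "B \<ge> 0" using f(2)[of 0] by linarith
  show "(\<lambda>n. expectation (\<lambda>\<omega>. real (W \<omega>) * f (min (W \<omega> - 1) n)))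
      \<longlonglongrightarrow> expectation (\<lambda>\<omega>. real (W \<omega>) * f (W \<omega> - 1))"
  proof (rule integral_dominated_convergence[where w = "\<lambda>\<omega>. real (W \<omega>) * B"])
    show "AE \<omega> in M. (\<lambda>n. real (W \<omega>) * f (min (W \<omega> - 1) n)) \<longlonglongrightarrow> real (W \<omega>) * f (W \<omega> - 1)"
    proof (rule AE_I2)
      fix \<omega>
      show "(\<lambda>n. real (W \<omega>) * f (min (W \<omega> - 1) n)) \<longlonglongrightarrow> real (W \<omega>) * f (W \<omega> - 1)"
        by (intro tendsto_eventually eventually_sequentiallyI[of "W \<omega> - 1"]) (simp add: min_absorb1)
    qed
  qed (use int f B in \<open>auto simp: abs_mult intro!: mult_left_mono\<close>)
  have "(\<lambda>n. expectation (\<lambda>\<omega>. f (min (W \<omega>) n))) \<longlonglongrightarrow> expectation (\<lambda>\<omega>. f (W \<omega>))"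
  proof (rule integral_dominated_convergence[where w = "\<lambda>\<omega>. B"])
    show "AE \<omega> in M. (\<lambda>n. f (min (W \<omega>) n)) \<longlonglongrightarrow> f (W \<omega>)"
    proof (rule AE_I2)
      fix \<omega>
      show "(\<lambda>n. f (min (W \<omega>) n)) \<longlonglongrightarrow> f (W \<omega>)"
        by (intro tendsto_eventually eventually_sequentiallyI[of "W \<omega>"]) (simp add: min_absorb1)
    qed
  qed (use f in auto)
  then show "(\<lambda>n. lam * expectation (\<lambda>\<omega>. f (min (W \<omega>) n))) \<longlonglongrightarrow> lam * expectation (\<lambda>\<omega>. f (W \<omega>))"
    by (intro tendsto_intros)
  have "expectation (\<lambda>\<omega>. real (W \<omega>) * f (min (W \<omega> - 1) n)) \<le> lam * expectation (\<lambda>\<omega>. f (min (W \<omega>) n))"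
    for n
  proof -
    let ?d = "\<lambda>k. f (Suc k) - f k"
    have int_ind: "integrable M (\<lambda>\<omega>. real (W \<omega>) * indicat_real {k<..} (W \<omega>))" for k
      by (rule Bochner_Integration.integrable_bound[OF int]) (auto simp: indicator_def)
    have int_ind': "integrable M (\<lambda>\<omega>. indicat_real {k<..} (W \<omega>))" for k
      by (rule integrable_const_bound[of _ 1]) (auto simp: indicator_def)
    have prob: "expectation (\<lambda>\<omega>. indicat_real {k<..} (W \<omega>)) = \<P>(\<omega> in M. W \<omega> \<ge> Suc k)" for k
    proof -
      have "expectation (\<lambda>\<omega>. indicat_real {k<..} (W \<omega>)) = expectation (indicat_real {\<omega>\<in>space M. W \<omega> \<ge> Suc k})"
        by (rule Bochner_Integration.integral_cong) (auto simp: indicator_def)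
      then show ?thesis by simp
    qed
    have "real m * f (min (m - 1) n)
        = f 0 * real m + (\<Sum>k<n. ?d k * (real m * indicat_real {Suc k<..} m))" for m
    proof -
      have "indicat_real {k<..} (m - 1) = indicat_real {Suc k<..} m" for k
        by (auto simp: indicator_def)
      then show ?thesis
        unfolding truncation_as_indicator_sum[of f "m - 1" n]
        by (simp add: algebra_simps sum_distrib_left)
    qed
    then have "expectation (\<lambda>\<omega>. real (W \<omega>) * f (min (W \<omega> - 1) n))
        = f 0 * lam + (\<Sum>k<n. ?d k * expectation (\<lambda>\<omega>. real (W \<omega>) * indicat_real {Suc k<..} (W \<omega>)))"
      using int int_ind by (simp add: mean)
    also have "\<dots> \<le> f 0 * lam + (\<Sum>k<n. ?d k * (lam * \<P>(\<omega> in M. W \<omega> \<ge> Suc k)))"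
      using tail monoD[OF f(1)] by (intro add_left_mono sum_mono mult_left_mono) auto
    also have "\<dots> = lam * (f 0 + (\<Sum>k<n. ?d k * expectation (\<lambda>\<omega>. indicat_real {k<..} (W \<omega>))))"
      by (simp add: prob algebra_simps sum_distrib_left)
    also have "\<dots> = lam * expectation (\<lambda>\<omega>. f (min (W \<omega>) n))"
      unfolding truncation_as_indicator_sum[of f _ n] using int_ind'
      by (simp add: prob_space del: sum_mult_indicator)
    finally show ?thesis .
  qed
  then show "\<exists>N. \<forall>n\<ge>N. expectation (\<lambda>\<omega>. real (W \<omega>) * f (min (W \<omega> - 1) n))
      \<le> lam * expectation (\<lambda>\<omega>. f (min (W \<omega>) n))"
    by blast
qed

text \<open>
  The generating function at \<open>s \<ge> 1\<close>, where \<open>f(w) = s\<^bsup>min w n\<^esup>\<close> is bounded and increasing. Truncation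
  at \<open>n + 1\<close> is matched to \<open>f\<close>: for \<open>w \<ge> 1\<close> one has \<open>min w (n + 1) - 1 = min (w - 1) n\<close>, so the slope
  of \<open>x \<mapsto> x\<^bsup>min w (n + 1)\<^esup>\<close> at \<open>s\<close> is at most \<open>w f(w - 1)\<close>, to which \<open>size_bias_mono\<close> applies.
\<close>

lemma truncated_pgf_le_poisson:
  fixes W :: "'a \<Rightarrow> nat"
  assumes W [measurable]: "W \<in> measurable M (count_space UNIV)"
    and int: "integrable M (\<lambda>\<omega>. real (W \<omega>))"
    and mean: "expectation (\<lambda>\<omega>. real (W \<omega>)) = lam"
    and tail: "\<And>k. expectation (\<lambda>\<omega>. real (W \<omega>) * indicat_real {k<..} (W \<omega>)) \<le> lam * \<P>(\<omega> in M. W \<omega> \<ge> k)"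
    and s: "s \<ge> 1"
  shows "expectation (\<lambda>\<omega>. s ^ min (W \<omega>) (Suc n)) \<le> exp (lam * (s - 1))"
proof -
  define x where "x u = 1 + u * (s - 1)" for u
  define G where "G u = expectation (\<lambda>\<omega>. x u ^ min (W \<omega>) (Suc n))" for u
  have lam: "lam \<ge> 0"
    unfolding mean[symmetric] by simp
  have int_pow: "integrable M (\<lambda>\<omega>. y ^ min (W \<omega>) k)" if "y \<ge> 1" for y :: real and k
    by (rule integrable_const_bound[of _ "y ^ k"]) (use that in \<open>auto intro!: power_increasing\<close>)
  have "G 1 \<le> exp (lam * (s - 1)) * G 0"
  proof (rule discrete_gronwall)
    fix u v :: real
    assume uv: "0 \<le> u" "u \<le> v" "v \<le> 1"
    have xu: "x u \<ge> 1" and xv: "x v \<ge> 1"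
      using uv s by (auto simp: x_def)
    have xd: "x v - x u = (v - u) * (s - 1)"
      by (simp add: x_def algebra_simps)
    have xd0: "x v - x u \<ge> 0"
      unfolding xd using uv s by simp
    have pt: "x v ^ min m (Suc n) - (x v - x u) * (real m * x v ^ min (m - 1) n)
        \<le> x u ^ min m (Suc n)" for m
    proof (cases m)
      case (Suc l)
      have "(x v - x u) * (real (min m (Suc n)) * x v ^ min l n)
          \<le> (x v - x u) * (real m * x v ^ min l n)"
        using xd0 xv by (intro mult_left_mono mult_right_mono) auto
      moreover have "x v ^ min m (Suc n) + real (min m (Suc n)) * x v ^ (min m (Suc n) - 1) * (x u - x v)
          \<le> x u ^ min m (Suc n)"
        using xu xv by (intro power_above_tangent) auto
      moreover have "min m (Suc n) - 1 = min l n"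
        using Suc by simp
      ultimately show ?thesis
        using Suc by (simp add: algebra_simps)
    qed simp
    have int_W: "integrable M (\<lambda>\<omega>. real (W \<omega>) * x v ^ min (W \<omega> - 1) n)"
    proof (rule Bochner_Integration.integrable_bound)
      show "integrable M (\<lambda>\<omega>. real (W \<omega>) * x v ^ n)" using int by simp
      show "AE \<omega> in M. norm (real (W \<omega>) * x v ^ min (W \<omega> - 1) n) \<le> norm (real (W \<omega>) * x v ^ n)"
        using xv by (auto intro!: mult_left_mono power_increasing simp: abs_mult)
    qed simp
    have "expectation (\<lambda>\<omega>. real (W \<omega>) * x v ^ min (W \<omega> - 1) n) \<le> lam * expectation (\<lambda>\<omega>. x v ^ min (W \<omega>) n)"
      using xv by (intro size_bias_mono[OF W int mean tail, where B = "x v ^ n"])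
        (auto intro!: monoI power_increasing)
    also have "\<dots> \<le> lam * G v"
      unfolding G_def using xv lam
      by (intro mult_left_mono integral_mono int_pow power_increasing) auto
    finally have slope: "expectation (\<lambda>\<omega>. real (W \<omega>) * x v ^ min (W \<omega> - 1) n) \<le> lam * G v" .
    have "(1 - lam * (s - 1) * (v - u)) * G v = G v - (x v - x u) * (lam * G v)"
      unfolding xd by (simp add: algebra_simps)
    also have "\<dots> \<le> G v - (x v - x u) * expectation (\<lambda>\<omega>. real (W \<omega>) * x v ^ min (W \<omega> - 1) n)"
      using slope xd0 by (intro diff_left_mono mult_left_mono)
    also have "\<dots> = expectation (\<lambda>\<omega>. x v ^ min (W \<omega>) (Suc n)
        - (x v - x u) * (real (W \<omega>) * x v ^ min (W \<omega> - 1) n))"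
      unfolding G_def using int_pow[OF xv] int_W by simp
    also have "\<dots> \<le> G u"
      unfolding G_def using int_pow[OF xv] int_pow[OF xu] int_W by (intro integral_mono pt) auto
    finally show "(1 - lam * (s - 1) * (v - u)) * G v \<le> G u" .
  qed
  then show ?thesis
    by (simp add: G_def x_def prob_space)
qed

text \<open>
  The generating function at \<open>0 < s \<le> 1\<close>. Now \<open>f(w) = s\<^sup>w\<close> is bounded and decreasing, so the
  size-bias inequality is applied to \<open>- f\<close>; moving from \<open>1\<close> down to \<open>s\<close> reverses signs once more.
\<close>

lemma pgf_le_poisson:
  fixes W :: "'a \<Rightarrow> nat"
  assumes W [measurable]: "W \<in> measurable M (count_space UNIV)"
    and int: "integrable M (\<lambda>\<omega>. real (W \<omega>))"
    and mean: "expectation (\<lambda>\<omega>. real (W \<omega>)) = lam"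
    and tail: "\<And>k. expectation (\<lambda>\<omega>. real (W \<omega>) * indicat_real {k<..} (W \<omega>)) \<le> lam * \<P>(\<omega> in M. W \<omega> \<ge> k)"
    and s: "0 < s" "s \<le> 1"
  shows "expectation (\<lambda>\<omega>. s ^ W \<omega>) \<le> exp (lam * (s - 1))"
proof -
  define x where "x u = 1 + u * (s - 1)" for u
  define G where "G u = expectation (\<lambda>\<omega>. x u ^ W \<omega>)" for u
  have int_pow: "integrable M (\<lambda>\<omega>. y ^ W \<omega>)" if "0 < y" "y \<le> 1" for y :: real
    by (rule integrable_const_bound[of _ 1]) (use that in \<open>auto intro!: power_le_one\<close>)
  have "G 1 \<le> exp (lam * (s - 1)) * G 0"
  proof (rule discrete_gronwall)
    fix u v :: real
    assume uv: "0 \<le> u" "u \<le> v" "v \<le> 1"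
    have x_range: "0 < x w \<and> x w \<le> 1" if "0 \<le> w" "w \<le> 1" for w
    proof -
      have "w * (1 - s) \<le> 1 * (1 - s)" "0 \<le> w * (1 - s)"
        using that s by (intro mult_right_mono mult_nonneg_nonneg; simp)+
      then show ?thesis using s by (simp add: x_def algebra_simps)
    qed
    have xu: "0 < x u" "x u \<le> 1" and xv: "0 < x v" "x v \<le> 1"
      using uv x_range[of u] x_range[of v] by auto
    have xd: "x u - x v = (v - u) * (1 - s)"
      by (simp add: x_def algebra_simps)
    have xd0: "x u - x v \<ge> 0"
      unfolding xd using uv s by simp
    have int_W: "integrable M (\<lambda>\<omega>. real (W \<omega>) * x v ^ (W \<omega> - 1))"
      by (rule Bochner_Integration.integrable_bound[OF int])
        (use xv in \<open>auto intro!: mult_left_le power_le_one simp: abs_mult\<close>)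
    have "expectation (\<lambda>\<omega>. real (W \<omega>) * - (x v ^ (W \<omega> - 1))) \<le> lam * expectation (\<lambda>\<omega>. - (x v ^ W \<omega>))"
      using xv by (intro size_bias_mono[OF W int mean tail, where B = 1])
        (auto intro!: monoI power_decreasing power_le_one)
    then have slope: "lam * G v \<le> expectation (\<lambda>\<omega>. real (W \<omega>) * x v ^ (W \<omega> - 1))"
      by (simp add: G_def)
    have "(1 - lam * (s - 1) * (v - u)) * G v = G v + (x u - x v) * (lam * G v)"
      unfolding xd by (simp add: algebra_simps)
    also have "\<dots> \<le> G v + (x u - x v) * expectation (\<lambda>\<omega>. real (W \<omega>) * x v ^ (W \<omega> - 1))"
      using slope xd0 by (intro add_left_mono mult_left_mono)
    also have "\<dots> = expectation (\<lambda>\<omega>. x v ^ W \<omega> + (x u - x v) * (real (W \<omega>) * x v ^ (W \<omega> - 1)))"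
      unfolding G_def using int_pow[OF xv] int_W by simp
    also have "\<dots> \<le> G u"
      unfolding G_def using int_pow[OF xv] int_pow[OF xu] int_W
    proof (intro integral_mono)
      fix \<omega>
      show "x v ^ W \<omega> + (x u - x v) * (real (W \<omega>) * x v ^ (W \<omega> - 1)) \<le> x u ^ W \<omega>"
        using power_above_tangent[OF xu(1) xv(1), of "W \<omega>"] by (simp add: mult_ac)
    qed auto
    finally show "(1 - lam * (s - 1) * (v - u)) * G v \<le> G u" .
  qed
  then show ?thesis
    by (simp add: G_def x_def prob_space)
qed

section \<open>The tail bounds\<close>

lemma markov_powr_bound:
  fixes Y :: "'a \<Rightarrow> real"
  assumes "integrable M Y" "\<And>\<omega>. Y \<omega> \<ge> 0" "expectation Y \<le> C" "c > 0"
    and "\<And>\<omega>. P \<omega> \<Longrightarrow> c powr a \<le> Y \<omega>"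
  shows "\<P>(\<omega> in M. P \<omega>) \<le> C * c powr (- a)"
proof -
  have "\<P>(\<omega> in M. P \<omega>) \<le> \<P>(\<omega> in M. Y \<omega> \<ge> c powr a)"
    using assms by (intro finite_measure_mono) auto
  also have "\<dots> \<le> expectation Y / c powr a"
    using assms by (intro integral_Markov_inequality_measure[where A = "{}"]) auto
  also have "\<dots> \<le> C / c powr a"
    using assms by (intro divide_right_mono) auto
  finally show ?thesis
    by (simp add: powr_minus divide_inverse)
qed

end

theorem corollary2p9:
  fixes M :: "'a measure" and N :: "'b measure"
    and W :: "'a \<Rightarrow> nat" and Wstar :: "'b \<Rightarrow> nat"
    and lam t :: real
  assumes "prob_space M" and "prob_space N"
    and "W \<in> measurable M (count_space UNIV)"
    and "Wstar \<in> measurable N (count_space UNIV)"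
    and "integrable M (\<lambda>\<omega>. real (W \<omega>))"
    and "(\<integral>\<omega>. real (W \<omega>) \<partial>M) = lam" and "lam > 0"
    and "has_size_biased_dist M W N Wstar"
    and "st_ge M (\<lambda>\<omega>. real (W \<omega>) + 1) N (\<lambda>\<omega>. real (Wstar \<omega>))"
    and "t > 0"
  shows "\<P>(\<omega> in M. real (W \<omega>) \<ge> lam + t) \<le> exp t * (1 + t / lam) powr (- (t + lam))
    \<and> (t < lam \<longrightarrow>
        \<P>(\<omega> in M. real (W \<omega>) \<le> lam - t) \<le> exp (- t) * (1 - t / lam) powr (t - lam))"
proof (intro conjI impI)
  interpret prob_space M by (rule assms(1))
  note W [measurable] = assms(3)
  note lam = \<open>lam > 0\<close> and t = \<open>t > 0\<close>
  have tail: "expectation (\<lambda>\<omega>. real (W \<omega>) * indicat_real {k<..} (W \<omega>)) \<le> lam * \<P>(\<omega> in M. W \<omega> \<ge> k)" for k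
  proof -
    have "\<P>(\<omega> in N. real (Wstar \<omega>) > real k) \<le> \<P>(\<omega> in M. real (W \<omega>) + 1 > real k)"
      using assms(9) unfolding st_ge_def by blast
    moreover have "real (W \<omega>) + 1 > real k \<longleftrightarrow> W \<omega> \<ge> k" for \<omega>
      by linarith
    ultimately have "\<P>(\<omega> in N. Wstar \<omega> > k) \<le> \<P>(\<omega> in M. W \<omega> \<ge> k)"
      by simp
    then show ?thesis
      using size_bias_tail[OF assms(2-8)] lam by simp
  qed
  note bound = assms(3,5,6) tail
  show "\<P>(\<omega> in M. real (W \<omega>) \<ge> lam + t) \<le> exp t * (1 + t / lam) powr (- (t + lam))"
  proof -
    define s where "s = 1 + t / lam"
    have s: "s \<ge> 1" "lam * (s - 1) = t"
      using lam t by (auto simp: s_def)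
    \<comment> \<open>Truncation above the level \<open>lam + t\<close> does not change the event.\<close>
    obtain n :: nat where n: "real n \<ge> lam + t"
      using real_arch_simple by blast
    have "\<P>(\<omega> in M. real (W \<omega>) \<ge> lam + t) \<le> exp t * s powr (- (t + lam))"
    proof (rule markov_powr_bound)
      show "integrable M (\<lambda>\<omega>. s ^ min (W \<omega>) (Suc n))"
        by (rule integrable_const_bound[of _ "s ^ Suc n"])
          (use s in \<open>auto intro!: power_increasing simp del: power_Suc\<close>)
      show "expectation (\<lambda>\<omega>. s ^ min (W \<omega>) (Suc n)) \<le> exp t"
        using truncated_pgf_le_poisson[OF bound s(1), of n] s(2) by simp
      show "s powr (t + lam) \<le> s ^ min (W \<omega>) (Suc n)" if "real (W \<omega>) \<ge> lam + t" for \<omega>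
      proof -
        have "s powr (t + lam) \<le> s powr real (min (W \<omega>) (Suc n))"
          using that n s by (intro powr_mono) auto
        then show ?thesis
          using s by (subst (asm) powr_realpow) auto
      qed
    qed (use s in auto)
    then show ?thesis by (simp add: s_def)
  qed
  show "\<P>(\<omega> in M. real (W \<omega>) \<le> lam - t) \<le> exp (- t) * (1 - t / lam) powr (t - lam)" if "t < lam"
  proof -
    define s where "s = 1 - t / lam"
    have s: "0 < s" "s \<le> 1" "lam * (s - 1) = - t"
      using lam t that by (auto simp: s_def)
    have "\<P>(\<omega> in M. real (W \<omega>) \<le> lam - t) \<le> exp (- t) * s powr (- (lam - t))"
    proof (rule markov_powr_bound)
      show "integrable M (\<lambda>\<omega>. s ^ W \<omega>)"
        by (rule integrable_const_bound[of _ 1]) (use s in \<open>auto intro!: power_le_one\<close>)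
      show "expectation (\<lambda>\<omega>. s ^ W \<omega>) \<le> exp (- t)"
        using pgf_le_poisson[OF bound s(1,2)] s(3) by simp
      show "s powr (lam - t) \<le> s ^ W \<omega>" if "real (W \<omega>) \<le> lam - t" for \<omega>
      proof -
        have "s powr (lam - t) \<le> s powr real (W \<omega>)"
          using that s by (intro powr_mono') auto
        then show ?thesis
          using s by (simp add: powr_realpow)
      qed
    qed (use s in auto)
    then show ?thesis by (simp add: s_def)
  qed
qed

end
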